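(* Let $N\ge1$. For a polynomial $P_N$ of degree $N$ with zeros $x_1,\dots,x_N$ (with multiplicity), let $G(N,z)=\sum_{r\ge0}m_r(N)z^r$ with $m_r(N)=\frac1N\sum_i x_i^r$; as a rational function of $z$, $G(N,z)=\frac1N\sum_i\frac1{1-zx_i}$. Then the following Riccati equations hold (as identities of rational functions, equivalently of formal power series, in $z$): (Jacobi $P_N^{(\alpha,\beta)}$, $\alpha,\beta>-1$; $G=G^{(\alpha,\beta)}$) $$\frac{(1-z^2)z}{N}\frac{\partial G}{\partial z}=\bigl(z^2+(\alpha-\beta)z+\alpha+\beta+1\bigr)\frac1N G+(1-z^2)G^2-\Bigl(1+\frac{1+\alpha+\beta}{N}\Bigr);$$ (Chebyshev $T_N$; $G=G^{(T)}$) $$\frac{(1-z^2)z}{N}\frac{\partial G}{\partial z}=\frac{z^2}{N}G+(1-z^2)G^2-1;$$ (Chebyshev $U_N$; $G=G^{(U)}$) $$\frac{(1-z^2)z}{N}\frac{\partial G}{\partial z}=\frac{2+z^2}{N}G+(1-z^2)G^2-\frac{N+2}{N};$$ (generalized Laguerre $L_N^{(\alpha)}$, $\alpha>-1$; $G=G^{(\alpha)}$) $$z^2\frac{\partial G}{\partial z}=Nz\,G^2+(\alpha z-1)G+1;$$ (scaled Laguerre $Ls_N^{(\alpha)}(x)=L_N^{(\alpha)}(Nx)$; $Q(N,z)=G^{(\alpha)}(N,z/N)$) $$\frac{z^2}{N}\frac{\partial Q}{\partial z}=z\,Q^2+\Bigl(\frac{\alpha z}{N}-1\Bigr)Q+1;$$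 (Hermite $H_N$; $G=G^{(H)}$) $$\frac{z^3}{2}\frac{\partial G}{\partial z}=\frac{z^2}{2}N\,G^2-\Bigl(1+\frac{z^2}{2}\Bigr)G+1;$$ (scaled Hermite $Hs_N(x)=H_N(\sqrt N x)$; $Q(N,z)=G^{(H)}(N,z/\sqrt N)$) $$\frac{z^3}{2N}\frac{\partial Q}{\partial z}=\frac{z^2}{2}Q^2-\Bigl(1+\frac{z^2}{2N}\Bigr)Q+1.$$
   Context: The polynomials have their standard definitions (Hermite polynomials are the physicists' ones, orthogonal with respect to $e^{-x^2}$). *)

theory Defs
  imports "HOL-Analysis.Analysis" "HOL-Computational_Algebra.Computational_Algebra"
begin

(* Zeros are complex zeros, listed with multiplicity by proots; a polynomial of degree N
   has exactly N of them, see size_proots_complex. *)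

definition zero_moment :: "nat \<Rightarrow> complex poly \<Rightarrow> nat \<Rightarrow> complex" where
  "zero_moment N P r = 1 / of_nat N * (\<Sum>x\<in>#proots P. x ^ r)"

definition moment_fps :: "nat \<Rightarrow> complex poly \<Rightarrow> complex fps" where
  "moment_fps N P = Abs_fps (zero_moment N P)"

definition moment_fun :: "nat \<Rightarrow> complex poly \<Rightarrow> complex \<Rightarrow> complex" where
  "moment_fun N P z = 1 / of_nat N * (\<Sum>x\<in>#proots P. 1 / (1 - z * x))"

text \<open>The points where the rational function \<open>moment_fun N P\<close> has no pole; the value 0 that
  division by 0 takes at the other points is meaningless.\<close>

definition regular_points :: "complex poly \<Rightarrow> complex set" where
  "regular_points P = {z. \<forall>x\<in>#proots P. z * x \<noteq> 1}"

abbreviation cpoly :: "real poly \<Rightarrow> complex poly" where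
  "cpoly \<equiv> map_poly complex_of_real"

text \<open>\<open>(\<alpha>+1)\<^sub>n / n! \<cdot> \<^sub>2F\<^sub>1(-n, n+\<alpha>+\<beta>+1; \<alpha>+1; (1-x)/2)\<close>; the denominators do not vanish
  for \<open>\<alpha> > -1\<close>.\<close>

definition jacobi_poly :: "real \<Rightarrow> real \<Rightarrow> nat \<Rightarrow> real poly" where
  "jacobi_poly \<alpha> \<beta> n = smult (pochhammer (\<alpha> + 1) n / fact n)
     (\<Sum>k\<le>n. smult (pochhammer (- real n) k * pochhammer (real n + \<alpha> + \<beta> + 1) k
                      / (pochhammer (\<alpha> + 1) k * fact k)) ([:1/2, -1/2:] ^ k))"

fun chebyshev_T :: "nat \<Rightarrow> real poly" where
  "chebyshev_T 0 = 1"
| "chebyshev_T (Suc 0) = [:0, 1:]"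
| "chebyshev_T (Suc (Suc n)) = [:0, 2:] * chebyshev_T (Suc n) - chebyshev_T n"

fun chebyshev_U :: "nat \<Rightarrow> real poly" where
  "chebyshev_U 0 = 1"
| "chebyshev_U (Suc 0) = [:0, 2:]"
| "chebyshev_U (Suc (Suc n)) = [:0, 2:] * chebyshev_U (Suc n) - chebyshev_U n"

definition laguerre_poly :: "real \<Rightarrow> nat \<Rightarrow> real poly" where
  "laguerre_poly \<alpha> n =
     (\<Sum>k\<le>n. monom ((-1) ^ k * ((real n + \<alpha>) gchoose (n - k)) / fact k) k)"

definition scaled_laguerre_poly :: "real \<Rightarrow> nat \<Rightarrow> real poly" where
  "scaled_laguerre_poly \<alpha> n = pcompose (laguerre_poly \<alpha> n) [:0, real n:]"

fun hermite_poly :: "nat \<Rightarrow> real poly" where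
  "hermite_poly 0 = 1"
| "hermite_poly (Suc 0) = [:0, 2:]"
| "hermite_poly (Suc (Suc n)) =
     [:0, 2:] * hermite_poly (Suc n) - smult (2 * real (Suc n)) (hermite_poly n)"

definition scaled_hermite_poly :: "nat \<Rightarrow> real poly" where
  "scaled_hermite_poly n = pcompose (hermite_poly n) [:0, sqrt (real n):]"

end

(* Put w = 1/z. Then S(z) = N G(z) equals w P'(w) / P(w), and (P'/P)' = P''/P - (P'/P)^2, so a
   differential equation A P'' + B P' + c P = 0 with deg A <= 2 and deg B <= 1 turns into a Riccati
   equation for S. At z = 0, where w is not available, the equation is the vanishing of
   the coefficient of x^N in the ODE, and the identity of power series follows from the one of
   functions by uniqueness of expansions. All the polynomials in question solve such an ODE;
   the scaled ones solve the ODE with rescaled coefficients. *)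

theory Submission
  imports Defs
begin

subsection \<open>From differential equations to Riccati equations\<close>

text \<open>With L = P'/P, M = P''/P and S = w L, the rule z d/dz = -w d/dw gives z S' = S^2 - S -
  w^2 M. Multiplying by z^2 A(1/z) = a2 + a1 z + a0 z^2 turns w^2 M into A(w) M, which the ODE
  replaces by -(b0 + b1 w) L - c = -(b1 + b0 z) S - c. The degree bounds on A and B make z^2 A(1/z)
  and z B(1/z) polynomials, so the equation still makes sense at z = 0. Multiple zeros are covered
  because P'/P counts zeros with multiplicity. The ODEs are reached in two ways. Laguerre and Jacobi
  polynomials are given by explicit coefficients, for which the ODE is a recurrence in the index k.
  Chebyshev and Hermite polynomials are given by recurrences in the degree, so identities for their
  derivatives have to be found first.\<close>

definition hypergeometric_ode ::
    "'a \<Rightarrow> 'a \<Rightarrow> 'a \<Rightarrow> 'a \<Rightarrow> 'a \<Rightarrow> 'a \<Rightarrow> 'a :: field_char_0 poly \<Rightarrow> bool" where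
  "hypergeometric_ode a0 a1 a2 b0 b1 c p \<longleftrightarrow>
     [:a0, a1, a2:] * pderiv (pderiv p) + [:b0, b1:] * pderiv p + smult c p = 0"

text \<open>Multiplication by x^j shifts coefficients by j, so the ODE becomes a three-term
  recurrence. In this form the passage to complex coefficients, the rescaling, the Laguerre and
  Jacobi cases and the condition at z = 0 can all be read off.\<close>

lemma hypergeometric_ode_iff_coeff:
  "hypergeometric_ode a0 a1 a2 b0 b1 c p \<longleftrightarrow>
     (\<forall>k. a0 * of_nat (k + 1) * of_nat (k + 2) * coeff p (k + 2)
        + (b0 + a1 * of_nat k) * of_nat (k + 1) * coeff p (k + 1)
        + (c + b1 * of_nat k + a2 * of_nat k * (of_nat k - 1)) * coeff p k = 0)"
proof -
  have "coeff ([:a0, a1, a2:] * pderiv (pderiv p) + [:b0, b1:] * pderiv p + smult c p) k =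
      a0 * of_nat (k + 1) * of_nat (k + 2) * coeff p (k + 2)
        + (b0 + a1 * of_nat k) * of_nat (k + 1) * coeff p (k + 1)
        + (c + b1 * of_nat k + a2 * of_nat k * (of_nat k - 1)) * coeff p k" for k
    \<comment> \<open>Products with x and x^2 shift the index down by one and two, so k = 0, k = 1
      and larger k are separate cases.\<close>
    by (cases k; cases "k - 1")
       (auto simp: coeff_pCons coeff_pderiv algebra_simps split: nat.splits)
  thus ?thesis
    by (simp add: hypergeometric_ode_def poly_eq_iff)
qed

lemma hypergeometric_ode_cpoly:
  assumes "hypergeometric_ode a0 a1 a2 b0 b1 c p"
  shows   "hypergeometric_ode (of_real a0) (of_real a1) (of_real a2) (of_real b0) (of_real b1)
             (of_real c) (cpoly p)"
  unfolding hypergeometric_ode_iff_coeff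
proof
  fix k
  have "a0 * of_nat (k + 1) * of_nat (k + 2) * coeff p (k + 2)
        + (b0 + a1 * of_nat k) * of_nat (k + 1) * coeff p (k + 1)
        + (c + b1 * of_nat k + a2 * of_nat k * (of_nat k - 1)) * coeff p k = 0"
    using assms unfolding hypergeometric_ode_iff_coeff by blast
  from arg_cong[OF this, of complex_of_real]
  show "of_real a0 * of_nat (k + 1) * of_nat (k + 2) * coeff (cpoly p) (k + 2)
        + (of_real b0 + of_real a1 * of_nat k) * of_nat (k + 1) * coeff (cpoly p) (k + 1)
        + (of_real c + of_real b1 * of_nat k + of_real a2 * of_nat k * (of_nat k - 1))
          * coeff (cpoly p) k = 0"
    by (simp add: coeff_map_poly)
qed

text \<open>Composition with e x multiplies the coefficient of x^k by e^k. The given constants are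
  the ones for which the k-th equation is just the old one times e^k.\<close>

lemma hypergeometric_ode_scale:
  assumes "hypergeometric_ode a0 a1 a2 b0 b1 c p" "e \<noteq> 0"
  shows   "hypergeometric_ode (a0 / e ^ 2) (a1 / e) a2 (b0 / e) b1 c (pcompose p [:0, e:])"
  unfolding hypergeometric_ode_iff_coeff
proof
  fix k
  have "e ^ k * (a0 * of_nat (k + 1) * of_nat (k + 2) * coeff p (k + 2)
        + (b0 + a1 * of_nat k) * of_nat (k + 1) * coeff p (k + 1)
        + (c + b1 * of_nat k + a2 * of_nat k * (of_nat k - 1)) * coeff p k) = 0"
    using assms unfolding hypergeometric_ode_iff_coeff by simp
  hence "e ^ k * (a0 * of_nat (k + 1) * of_nat (k + 2) * coeff p (k + 2))
        + e ^ k * ((b0 + a1 * of_nat k) * of_nat (k + 1) * coeff p (k + 1))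
        + e ^ k * ((c + b1 * of_nat k + a2 * of_nat k * (of_nat k - 1)) * coeff p k) = 0"
    by (simp only: distrib_left)
  moreover have "a0 / e ^ 2 * x * y * (e ^ (k + 2) * z) = e ^ k * (a0 * x * y * z)" 
      "(b0 / e + a1 / e * x) * y * (e ^ (k + 1) * z) = e ^ k * ((b0 + a1 * x) * y * z)"
      "x * (e ^ k * y) = e ^ k * (x * y)" for x y z
    using assms(2) by (simp_all add: field_simps power2_eq_square)
  ultimately show "a0 / e ^ 2 * of_nat (k + 1) * of_nat (k + 2) * coeff (pcompose p [:0, e:]) (k + 2)
        + (b0 / e + a1 / e * of_nat k) * of_nat (k + 1) * coeff (pcompose p [:0, e:]) (k + 1)
        + (c + b1 * of_nat k + a2 * of_nat k * (of_nat k - 1)) * coeff (pcompose p [:0, e:]) k = 0"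
    by (simp only: coeff_pcompose_linear)
qed

section \<open>The moment function as a power series and as a logarithmic derivative\<close>

lemma moment_fun_at_0: "degree P = N \<Longrightarrow> N \<ge> 1 \<Longrightarrow> moment_fun N P 0 = 1"
  by (simp add: moment_fun_def size_proots_complex)

lemma regular_points_0 [simp]: "0 \<in> regular_points P"
  by (simp add: regular_points_def)

text \<open>Finitely many open conditions. Openness allows differentiating a formula valid on the
  regular points and comparing germs at 0.\<close>

lemma open_regular_points: "open (regular_points P)"
proof -
  have "regular_points P = (\<Inter>x\<in>set_mset (proots P). {z. z * x \<noteq> 1})"
    by (auto simp: regular_points_def)
  moreover have "open {z. z * x \<noteq> 1}" for x :: complex
    by (intro open_Collect_neq continuous_intros)
  ultimately show ?thesis
    by auto
qed

lemma regular_points_iff: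
  assumes "P \<noteq> 0" "z \<noteq> 0"
  shows   "z \<in> regular_points P \<longleftrightarrow> poly P (1 / z) \<noteq> 0"
proof -
  have "z * x = 1 \<longleftrightarrow> x = 1 / z" for x
    using assms(2) by (auto simp: field_simps)
  thus ?thesis
    using assms(1) by (auto simp: regular_points_def)
qed

text \<open>Each zero contributes a geometric series; these are summed by induction over the
  multiset of zeros.\<close>

lemma moment_fun_has_fps_expansion: "moment_fun N P has_fps_expansion moment_fps N P"
proof -
  have geo: "(\<lambda>z. 1 / (1 - z * x)) has_fps_expansion Abs_fps (\<lambda>n. x ^ n)" for x :: complex
  proof -
    have eq: "(1 - fps_X * fps_const x) * Abs_fps (\<lambda>n. x ^ n) = 1"
      by (rule fps_ext) (simp add: ring_distribs mult.assoc power_eq_if)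
    have "(\<lambda>z. inverse (1 - z * x)) has_fps_expansion inverse (1 - fps_X * fps_const x)"
      by (intro fps_expansion_intros) auto
    moreover have "inverse (1 - fps_X * fps_const x) = Abs_fps (\<lambda>n. x ^ n)"
      by (rule fps_inverse_unique) (fact eq)
    ultimately show ?thesis by (simp add: inverse_eq_divide)
  qed
  have "(\<lambda>z. \<Sum>x\<in>#A. 1 / (1 - z * x)) has_fps_expansion Abs_fps (\<lambda>n. \<Sum>x\<in>#A. x ^ n)"
    for A :: "complex multiset"
  proof (induction A)
    case (add x A)
    have "Abs_fps (\<lambda>n. \<Sum>y\<in>#add_mset x A. y ^ n) =
        Abs_fps (\<lambda>n. x ^ n) + Abs_fps (\<lambda>n. \<Sum>y\<in>#A. y ^ n)"
      by (simp add: fps_eq_iff)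
    with has_fps_expansion_add[OF geo[of x] add.IH] show ?case
      by simp
  qed (auto simp flip: fps_zero_def)
  from has_fps_expansion_cmult_left[OF this, of "1 / of_nat N" "proots P"] show ?thesis
    \<comment> \<open>The fact fits the goal only up to unfolding, both in the function and in the
      series; the rule leaves these two equalities to prove.\<close>
    by (rule back_subst[of "\<lambda>F. F has_fps_expansion _", THEN has_fps_expansion_schematicI])
       (auto simp: moment_fun_def moment_fps_def zero_moment_def fps_eq_iff fun_eq_iff)
qed

text \<open>By the product rule, a further factor X - y adds 1 / (w - y) to the logarithmic
  derivative. The leading coefficient cancels in the quotient.\<close>

lemma poly_pderiv_div_poly:
  fixes P :: "complex poly"
  assumes "poly P w \<noteq> 0"
  shows   "(\<Sum>x\<in>#proots P. 1 / (w - x)) = poly (pderiv P) w / poly P w"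
proof -
  have *: "(\<Sum>x\<in>#A. 1 / (w - x)) = poly (pderiv (\<Prod>x\<in>#A. [:-x, 1:])) w / poly (\<Prod>x\<in>#A. [:-x, 1:]) w"
    if "w \<notin># A" for A :: "complex multiset"
    using that
  proof (induction A)
    case (add y A)
    have "poly (\<Prod>x\<in>#A. [:-x, 1:]) w \<noteq> 0"
      using add.prems by (auto simp: poly_prod_mset prod_mset_zero_iff)
    moreover have "poly (pderiv (\<Prod>x\<in>#add_mset y A. [:-x, 1:])) w =
        (w - y) * poly (pderiv (\<Prod>x\<in>#A. [:-x, 1:])) w + poly (\<Prod>x\<in>#A. [:-x, 1:]) w"
      unfolding image_mset_add_mset prod_mset.add_mset pderiv_mult by (simp add: pderiv_pCons left_diff_distrib)
    moreover have "poly (\<Prod>x\<in>#add_mset y A. [:-x, 1:]) w = (w - y) * poly (\<Prod>x\<in>#A. [:-x, 1:]) w"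
      by (simp add: algebra_simps)
    ultimately show ?case
      using add by (simp add: add_divide_distrib)
  qed auto
  have "P \<noteq> 0"
    using assms by auto
  hence "w \<notin># proots P"
    using assms by auto
  from *[OF this] have "(\<Sum>x\<in>#proots P. 1 / (w - x)) =
      poly (pderiv (smult (lead_coeff P) (\<Prod>x\<in>#proots P. [:-x, 1:]))) w /
      poly (smult (lead_coeff P) (\<Prod>x\<in>#proots P. [:-x, 1:])) w"
    using \<open>P \<noteq> 0\<close> by (simp add: pderiv_smult)
  thus ?thesis
    by (simp only: complex_poly_decompose_multiset)
qed

lemma moment_fun_eq:
  assumes "P \<noteq> 0" "z \<noteq> 0" "z \<in> regular_points P"
  shows   "moment_fun N P z =
             poly (pderiv P) (1 / z) / (of_nat N * z * poly P (1 / z))"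
proof -
  have "poly P (1 / z) \<noteq> 0"
    using assms regular_points_iff by auto
  from poly_pderiv_div_poly[OF this]
  have "(\<Sum>x\<in>#proots P. 1 / (1 / z - x)) / (of_nat N * z) =
      poly (pderiv P) (1 / z) / (of_nat N * z * poly P (1 / z))"
    by simp
  \<comment> \<open>For z x = 1 both sides are 0 by the convention on division, so the identity
    holds for every x and can be applied under the sum.\<close>
  moreover have "1 / (1 / z - x) = z * (1 / (1 - z * x))" for x
    using assms(2) by (cases "z * x = 1") (auto simp: field_simps)
  hence "(\<Sum>x\<in>#proots P. 1 / (1 / z - x)) = z * (\<Sum>x\<in>#proots P. 1 / (1 - z * x))"
    by (simp only: sum_mset_distrib_left)
  ultimately show ?thesis
    using assms(2) by (simp add: moment_fun_def)
qed

lemma has_field_derivative_moment_fun: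
  assumes "P \<noteq> 0" "z \<noteq> 0" "z \<in> regular_points P" "N \<ge> 1"
  defines "w \<equiv> 1 / z"
  shows   "(moment_fun N P has_field_derivative
             (- (w ^ 2) / of_nat N * (poly (pderiv P) w / poly P w
               + w * (poly (pderiv (pderiv P)) w / poly P w
                 - (poly (pderiv P) w / poly P w) ^ 2)))) (at z)"
proof (rule has_field_derivative_transform_within_open)
  have nz: "poly P w \<noteq> 0"
    using assms regular_points_iff by auto
  show "((\<lambda>z. poly (pderiv P) (1 / z) / (of_nat N * z * poly P (1 / z)))
          has_field_derivative
             (- (w ^ 2) / of_nat N * (poly (pderiv P) w / poly P w
               + w * (poly (pderiv (pderiv P)) w / poly P w
                 - (poly (pderiv P) w / poly P w) ^ 2)))) (at z)"
    using assms(2,4) nz unfolding w_def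
    by (auto intro!: derivative_eq_intros DERIV_chain2[OF poly_DERIV]
             simp: field_simps power2_eq_square power4_eq_xxxx)
  \<comment> \<open>The formula being differentiated agrees with \<open>moment_fun\<close> only away
    from 0.\<close>
  show "open (regular_points P \<inter> -{0})"
    by (intro open_Int open_regular_points) auto
qed (use assms moment_fun_eq in auto)

text \<open>The coefficient of the square is z^2 A(1/z). The linear coefficient is z B(1/z) - z^2
  A(1/z), whose second part comes from the term -S in z S'.\<close>

lemma moment_fun_riccati:
  assumes "hypergeometric_ode a0 a1 a2 b0 b1 c P" "degree P = N" "N \<ge> 1" "z \<in> regular_points P"
  shows   "z * (a2 + a1 * z + a0 * z ^ 2) * of_nat N * deriv (moment_fun N P) z =
             (a2 + a1 * z + a0 * z ^ 2) * (of_nat N * moment_fun N P z) ^ 2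
             + (b1 - a2 + (b0 - a1) * z - a0 * z ^ 2) * (of_nat N * moment_fun N P z) + c"
proof (cases "z = 0")
  case True
  from assms have "P \<noteq> 0" by auto
  \<comment> \<open>This is the recurrence at k = N, where the coefficients of index N + 1 and N + 2
    vanish. As the moment function is 1 at 0, the Riccati equation there says precisely that the
    first factor is 0.\<close>
  have "(c + b1 * of_nat N + a2 * of_nat N * (of_nat N - 1)) * coeff P N = 0"
    using assms(1,2) unfolding hypergeometric_ode_iff_coeff
    by (metis (no_types, lifting) add.left_neutral coeff_eq_0 less_add_same_cancel1 mult_zero_right zero_less_numeral zero_less_one)
  moreover have "coeff P N \<noteq> 0"
    using \<open>P \<noteq> 0\<close> assms(2) by auto
  ultimately have "c + b1 * of_nat N + a2 * of_nat N * (of_nat N - 1) = 0"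
    by simp
  thus ?thesis
    using True assms by (simp add: moment_fun_at_0 algebra_simps power2_eq_square)
next
  case False
  from assms have "P \<noteq> 0" by auto
  define w where "w = 1 / z"
  have nz: "poly P w \<noteq> 0"
    using assms \<open>P \<noteq> 0\<close> False regular_points_iff by (auto simp: w_def)
  define L where "L = poly (pderiv P) w / poly P w"
  define M where "M = poly (pderiv (pderiv P)) w / poly P w"
  have z: "z = 1 / w" "w \<noteq> 0"
    using False by (auto simp: w_def)
  have "poly ([:a0, a1, a2:] * pderiv (pderiv P) + [:b0, b1:] * pderiv P + smult c P) w = 0"
    using assms(1) by (simp add: hypergeometric_ode_def)
  hence "((a0 + a1 * w + a2 * w ^ 2) * poly (pderiv (pderiv P)) w
           + (b0 + b1 * w) * poly (pderiv P) w + c * poly P w) / poly P w = 0"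
    by (simp add: algebra_simps power2_eq_square)
  hence ode: "(a0 + a1 * w + a2 * w ^ 2) * M + (b0 + b1 * w) * L + c = 0"
    using nz by (simp add: add_divide_distrib M_def L_def)
  have g: "of_nat N * moment_fun N P z = w * L"
    using moment_fun_eq[OF \<open>P \<noteq> 0\<close> False assms(4), of N] assms(3)
    by (simp add: w_def L_def)
  have "deriv (moment_fun N P) z = - (w ^ 2) / of_nat N * (L + w * (M - L ^ 2))"
    unfolding L_def M_def w_def
    using has_field_derivative_moment_fun[OF \<open>P \<noteq> 0\<close> False assms(4,3)]
    by (rule DERIV_imp_deriv)
  hence g': "of_nat N * deriv (moment_fun N P) z = - (w ^ 2) * (L + w * (M - L ^ 2))"
    using assms(3) by simp
  have zw: "z * w = 1" using z by simp
  have "z * (a2 + a1 * z + a0 * z ^ 2) * of_nat N * deriv (moment_fun N P) z =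
     z * (a2 + a1 * z + a0 * z ^ 2) * (- (w ^ 2) * (L + w * (M - L ^ 2)))"
    using g' by (metis mult.assoc)
  also have "\<dots> = (a2 + a1 * z + a0 * z ^ 2) * (w * L) ^ 2
             + (b1 - a2 + (b0 - a1) * z - a0 * z ^ 2) * (w * L) + c"
    using ode zw by algebra
  finally show ?thesis
    unfolding g .
qed

lemma moment_fps_eqI:
  assumes "\<forall>z\<in>regular_points P. poly A z * deriv (moment_fun N P) z =
             poly B z * moment_fun N P z + poly C z * (moment_fun N P z) ^ 2 + poly D z"
  shows   "fps_of_poly A * fps_deriv (moment_fps N P) =
             fps_of_poly B * moment_fps N P + fps_of_poly C * (moment_fps N P) ^ 2 + fps_of_poly D"
proof -
  have p: "poly Q has_fps_expansion fps_of_poly Q" for Q :: "complex poly"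
    by (simp add: has_fps_expansion_def)
  note intros = has_fps_expansion_add has_fps_expansion_mult has_fps_expansion_deriv p
    moment_fun_has_fps_expansion
  define f where "f = (\<lambda>z. poly A z * deriv (moment_fun N P) z)"
  \<comment> \<open>The square is spelt as a product so that the rule for products of expansions
    applies.\<close>
  define g where "g = (\<lambda>z. poly B z * moment_fun N P z
    + poly C z * (moment_fun N P z * moment_fun N P z) + poly D z)"
  have f: "f has_fps_expansion fps_of_poly A * fps_deriv (moment_fps N P)"
    unfolding f_def by (intro intros)
  have g: "g has_fps_expansion fps_of_poly B * moment_fps N P
      + fps_of_poly C * (moment_fps N P * moment_fps N P) + fps_of_poly D"
    unfolding g_def by (intro intros)
  have "eventually (\<lambda>z. z \<in> regular_points P) (nhds 0)"
    by (intro eventually_nhds_in_open open_regular_points) auto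
  hence "eventually (\<lambda>z. f z = g z) (nhds 0)"
    by eventually_elim (use assms in \<open>auto simp: f_def g_def power2_eq_square\<close>)
  \<comment> \<open>Functions that agree near 0 have the same higher derivatives at 0, and these
    determine the coefficients of the expansions.\<close>
  from higher_deriv_cong_ev[OF this refl] show ?thesis
    unfolding fps_eq_iff power2_eq_square fps_nth_fps_expansion[OF f] fps_nth_fps_expansion[OF g]
    by simp
qed

text \<open>The factor \<open>s\<close> only serves to reach the various normalisations of the Riccati equation.\<close>

lemma moment_riccati:
  fixes s :: complex
  assumes "hypergeometric_ode a0 a1 a2 b0 b1 c P" "degree P = N" "N \<ge> 1"
    and A: "A = smult (s * of_nat N) [:0, a2, a1, a0:]"
    and B: "B = smult (s * of_nat N) [:b1 - a2, b0 - a1, -a0:]"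
    and C: "C = smult (s * of_nat N ^ 2) [:a2, a1, a0:]"
    and D: "D = [:s * c:]"
  shows   "\<forall>z\<in>regular_points P. poly A z * deriv (moment_fun N P) z =
             poly B z * moment_fun N P z + poly C z * (moment_fun N P z) ^ 2 + poly D z"
          (is ?fun)
    and   "fps_of_poly A * fps_deriv (moment_fps N P) =
             fps_of_poly B * moment_fps N P + fps_of_poly C * (moment_fps N P) ^ 2 + fps_of_poly D"
proof -
  show ?fun
  proof
    fix z assume "z \<in> regular_points P"
    from moment_fun_riccati[OF assms(1-3) this]
    show "poly A z * deriv (moment_fun N P) z =
            poly B z * moment_fun N P z + poly C z * (moment_fun N P z) ^ 2 + poly D z"
      unfolding A B C D by simp algebra
  qed
  thus "fps_of_poly A * fps_deriv (moment_fps N P) =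
          fps_of_poly B * moment_fps N P + fps_of_poly C * (moment_fps N P) ^ 2 + fps_of_poly D"
    by (rule moment_fps_eqI)
qed

text \<open>Since e X - x = e (X - x/e), composing with e X divides every zero by e and keeps
  multiplicities. This divides m_r by e^r, which amounts to replacing z by z/e.\<close>

lemma moment_fun_scale:
  fixes P :: "complex poly"
  assumes "e \<noteq> 0"
  shows   "moment_fun N (pcompose P [:0, e:]) = (\<lambda>z. moment_fun N P (z / e))"
    and   "moment_fps N (pcompose P [:0, e:]) = moment_fps N P oo (fps_const (1 / e) * fps_X)"
proof -
  have "proots (pcompose P [:0, e:]) = image_mset (\<lambda>x. x / e) (proots P)"
  proof (cases "P = 0")
    case False
    have lin: "proots [:-x, e:] = {#x / e#}" for x
    proof -
      have "[:-x, e:] = smult e [:-(x / e), 1:]"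
        using assms by simp
      thus ?thesis
        using proots_smult[OF assms, of "[:-(x / e), 1:]"] proots_linear_factor[of "-(x / e)"]
        by (simp only: minus_minus)
    qed
    have "proots (pcompose (\<Prod>x\<in>#A. [:-x, 1:]) [:0, e:]) = image_mset (\<lambda>x. x / e) A" for A
    proof (induction A)
      case (add x A)
      have "pcompose (\<Prod>x\<in>#A. [:-x, 1:]) [:0, e:] \<noteq> 0"
        using assms by (subst pcompose_eq_0_iff) (auto simp: prod_mset_zero_iff)
      with add assms show ?case
        unfolding image_mset_add_mset prod_mset.add_mset pcompose_mult
        by (subst proots_mult) (auto simp: pcompose_pCons lin)
    qed (simp add: pcompose_1)
    moreover have "proots (pcompose P [:0, e:]) =
        proots (pcompose (smult (lead_coeff P) (\<Prod>x\<in>#proots P. [:-x, 1:])) [:0, e:])"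
      by (simp only: complex_poly_decompose_multiset)
    ultimately show ?thesis
      using False by (simp add: pcompose_smult)
  qed auto
  thus "moment_fun N (pcompose P [:0, e:]) = (\<lambda>z. moment_fun N P (z / e))"
    and "moment_fps N (pcompose P [:0, e:]) = moment_fps N P oo (fps_const (1 / e) * fps_X)"
    unfolding fps_compose_linear
    by (simp_all add: moment_fun_def moment_fps_def zero_moment_def fps_eq_iff
          fun_eq_iff image_mset.compositionality o_def power_divide sum_mset_distrib_left mult_ac)
qed

subsection \<open>Differential equations of the classical polynomials\<close>

text \<open>With x = cos t, these are the addition formulas for cos((n+2)t) and sin((n+2)t), the
  latter divided by sin t. They are proved together because the induction step for the first one
  uses both.\<close>

lemma chebyshev_mutual_rec:
  "chebyshev_T (Suc (Suc n)) = [:0, 1:] * chebyshev_T (Suc n) - [:1, 0, -1:] * chebyshev_U n"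
  "chebyshev_U (Suc n) = [:0, 1:] * chebyshev_U n + chebyshev_T (Suc n)"
proof -
  \<comment> \<open>With an opaque \<open>X\<close>, the claims become ring identities within reach
    of \<open>algebra\<close>.\<close>
  define X :: "real poly" where "X = [:0, 1:]"
  have X: "[:0, 2:] = 2 * X" "[:1, 0, -1:] = 1 - X ^ 2"
    by (simp_all add: X_def power2_eq_square numeral_poly one_pCons)
  have "chebyshev_T (Suc (Suc n)) = X * chebyshev_T (Suc n) - (1 - X ^ 2) * chebyshev_U n
      \<and> chebyshev_U (Suc n) = X * chebyshev_U n + chebyshev_T (Suc n)"
  proof (induction n)
    case 0
    show ?case
      by (simp add: X) (simp add: X_def power2_eq_square numeral_poly)
  next
    case (Suc n)
    have "chebyshev_T (Suc (Suc (Suc n))) = 2 * X * chebyshev_T (Suc (Suc n)) - chebyshev_T (Suc n)"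
      and "chebyshev_U (Suc (Suc n)) = 2 * X * chebyshev_U (Suc n) - chebyshev_U n"
      by (simp_all add: X)
    with Suc show ?case by algebra
  qed
  thus "chebyshev_T (Suc (Suc n)) = [:0, 1:] * chebyshev_T (Suc n) - [:1, 0, -1:] * chebyshev_U n"
    and "chebyshev_U (Suc n) = [:0, 1:] * chebyshev_U n + chebyshev_T (Suc n)"
    unfolding X X_def[symmetric] by blast+
qed

text \<open>Differentiating the mutual recurrences expresses each derivative at the next index
  through both derivatives at the current one, hence the joint induction.\<close>

lemma chebyshev_pderiv:
  "pderiv (chebyshev_T (Suc n)) = of_nat (Suc n) * chebyshev_U n"
  "[:1, 0, -1:] * pderiv (chebyshev_U n) =
     [:0, 1:] * chebyshev_U n - of_nat (Suc n) * chebyshev_T (Suc n)"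
proof -
  define X :: "real poly" where "X = [:0, 1:]"
  have X: "[:1, 0, -1:] = 1 - X ^ 2" "pderiv X = 1"
    by (simp_all add: X_def power2_eq_square pderiv_pCons one_pCons)
  have pX: "pderiv (1 - X ^ 2) = - 2 * X"
    by (simp add: power2_eq_square pderiv_diff pderiv_mult X)
  have "pderiv (chebyshev_T (Suc n)) = of_nat (Suc n) * chebyshev_U n \<and>
    (1 - X ^ 2) * pderiv (chebyshev_U n) = X * chebyshev_U n - of_nat (Suc n) * chebyshev_T (Suc n)"
  proof (induction n)
    case 0
    show ?case by (simp add: X_def pderiv_pCons)
  next
    case (Suc n)
    have rec: "chebyshev_T (Suc (Suc n)) = X * chebyshev_T (Suc n) - (1 - X ^ 2) * chebyshev_U n"
      "chebyshev_U (Suc n) = X * chebyshev_U n + chebyshev_T (Suc n)"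
      using chebyshev_mutual_rec[of n] by (simp_all only: X X_def[symmetric])
    have "pderiv (chebyshev_T (Suc (Suc n))) =
        X * pderiv (chebyshev_T (Suc n)) + chebyshev_T (Suc n)
          - ((1 - X ^ 2) * pderiv (chebyshev_U n) - 2 * X * chebyshev_U n)"
      unfolding rec(1) pderiv_diff pderiv_mult X pX[unfolded pderiv_diff] by simp
    moreover have "pderiv (chebyshev_U (Suc n)) =
        X * pderiv (chebyshev_U n) + chebyshev_U n + pderiv (chebyshev_T (Suc n))"
      unfolding rec(2) pderiv_add pderiv_mult X by simp
    moreover have "of_nat (Suc (Suc n)) = (of_nat (Suc n) + 1 :: real poly)"
      by simp
    ultimately show ?case
      using Suc rec by algebra
  qed
  thus "pderiv (chebyshev_T (Suc n)) = of_nat (Suc n) * chebyshev_U n"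
    and "[:1, 0, -1:] * pderiv (chebyshev_U n) =
           [:0, 1:] * chebyshev_U n - of_nat (Suc n) * chebyshev_T (Suc n)"
    unfolding X X_def[symmetric] by blast+
qed

text \<open>As T_N' = N U_{N-1}, the ODE is N times the first-order identity for U_{N-1}.\<close>

lemma hypergeometric_ode_chebyshev_T:
  "hypergeometric_ode 1 0 (-1) 0 (-1) (real N ^ 2) (chebyshev_T N)"
proof (cases N)
  case (Suc n)
  have "[:1, 0, -1:] * pderiv (of_nat (Suc n) * chebyshev_U n) + [:0, -1:] * (of_nat (Suc n) * chebyshev_U n)
      + of_nat (Suc n) ^ 2 * chebyshev_T (Suc n) = 0"
  proof -
    have "[:0, -1:] = (- [:0, 1:] :: real poly)" by simp
    moreover have "pderiv (of_nat (Suc n) * chebyshev_U n) = of_nat (Suc n) * pderiv (chebyshev_U n)"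
      unfolding pderiv_mult pderiv_of_nat by simp
    ultimately show ?thesis
      using chebyshev_pderiv(2)[of n] by algebra
  qed
  moreover have "of_nat (Suc n) ^ 2 * p = smult (real (Suc n) ^ 2) p" for p
    by (simp only: of_nat_poly power2_eq_square mult.assoc) simp
  ultimately show ?thesis
    unfolding hypergeometric_ode_def Suc chebyshev_pderiv(1) by simp
qed (simp add: hypergeometric_ode_def)

text \<open>The first-order identity for U_N is differentiated once, with T_{N+1}' = (N+1) U_N. The
  constants arise as -3 = -2 - 1 and N (N+2) = (N+1)^2 - 1.\<close>

lemma hypergeometric_ode_chebyshev_U:
  "hypergeometric_ode 1 0 (-1) 0 (-3) (real N * (real N + 2)) (chebyshev_U N)"
proof -
  let ?U = "chebyshev_U N"
  note arg_cong[OF chebyshev_pderiv(2)[of N], of pderiv]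
  hence "[:1, 0, -1:] * pderiv (pderiv ?U) + pderiv ?U * pderiv [:1, 0, -1:] =
    [:0, 1:] * pderiv ?U + ?U * pderiv [:0, 1:] - of_nat (Suc N) * (of_nat (Suc N) * ?U)"
    by (simp only: pderiv_diff pderiv_mult chebyshev_pderiv(1) pderiv_of_nat mult_zero_right add_0_right)
  moreover have "pderiv [:1, 0, -1:] = [:0, -2 :: real:]" "pderiv [:0, 1:] = [:1 :: real:]"
    by (simp_all add: pderiv_pCons)
  moreover have "of_nat (Suc N) * (of_nat (Suc N) * p) = smult ((real N + 1) ^ 2) p" for p
    by (simp only: of_nat_poly) (simp add: power2_eq_square algebra_simps)
  ultimately have "[:1, 0, -1:] * pderiv (pderiv ?U) + pderiv ?U * [:0, -2:] =
    [:0, 1:] * pderiv ?U + ?U - smult ((real N + 1) ^ 2) ?U"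
    by simp
  moreover have "[:0, -3:] * pderiv ?U = pderiv ?U * [:0, -2:] - [:0, 1:] * pderiv ?U"
    using smult_add_left[of 2 1 "pderiv ?U"] by simp
  moreover have "smult (real N * (real N + 2)) ?U = smult ((real N + 1) ^ 2) ?U - ?U"
    by (simp add: power2_eq_square algebra_simps smult_add_left)
  ultimately show ?thesis
    unfolding hypergeometric_ode_def by algebra
qed

lemma degree_chebyshev_T: "degree (chebyshev_T n) = n"
proof (induction n rule: chebyshev_T.induct)
  case (3 n)
  hence "chebyshev_T (Suc n) \<noteq> 0" by auto
  hence "degree ([:0, 2:] * chebyshev_T (Suc n)) = Suc (Suc n)"
    using 3 by (subst degree_mult_eq) auto
  thus ?case
    using 3 by (simp only: chebyshev_T.simps diff_conv_add_uminus) (subst degree_add_eq_left; simp)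
qed auto

lemma degree_chebyshev_U: "degree (chebyshev_U n) = n"
proof (induction n rule: chebyshev_U.induct)
  case (3 n)
  hence "chebyshev_U (Suc n) \<noteq> 0" by auto
  hence "degree ([:0, 2:] * chebyshev_U (Suc n)) = Suc (Suc n)"
    using 3 by (subst degree_mult_eq) auto
  thus ?case
    using 3 by (simp only: chebyshev_U.simps diff_conv_add_uminus) (subst degree_add_eq_left; simp)
qed auto

section \<open>Hermite polynomials\<close>

text \<open>Differentiating the recurrence and inserting the two preceding cases produces a multiple
  of the recurrence one degree lower, plus the term from differentiating 2x.\<close>

lemma pderiv_hermite: "pderiv (hermite_poly (Suc n)) = smult (2 * real (Suc n)) (hermite_poly n)"
proof (induction n rule: induct_nat_012)
  case (ge2 n)
  have "pderiv (hermite_poly (Suc (Suc (Suc n)))) =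
     smult (2 * real (Suc (Suc n))) ([:0, 2:] * hermite_poly (Suc n)) + smult 2 (hermite_poly (Suc (Suc n)))
      - smult (2 * real (Suc (Suc n))) (smult (2 * real (Suc n)) (hermite_poly n))"
    using ge2
    by (simp only: hermite_poly.simps(3)[of "Suc n"] pderiv_diff pderiv_mult pderiv_smult)
       (simp add: pderiv_pCons)
  also have "\<dots> = smult (2 * real (Suc (Suc n))) (hermite_poly (Suc (Suc n))) + smult 2 (hermite_poly (Suc (Suc n)))"
    by (simp add: smult_diff_right)
  also have "\<dots> = smult (2 * real (Suc (Suc (Suc n)))) (hermite_poly (Suc (Suc n)))"
    by (simp only: smult_add_left [symmetric]) simp
  finally show ?case .
qed (simp_all add: pderiv_pCons pderiv_diff numeral_poly)

text \<open>Lowering the degree by the derivative rule, twice in H'' and once in H', makes the ODE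
  2N times the three-term recurrence. That recurrence starts at degree 2, so N = 0 and N = 1 are
  checked separately.\<close>

lemma hypergeometric_ode_hermite:
  "hypergeometric_ode 1 0 0 0 (-2) (2 * real N) (hermite_poly N)"
proof (cases N)
  case (Suc n)
  show ?thesis
  proof (cases n)
    case (Suc m)
    let ?c = "2 * real (Suc (Suc m))"
    have d2: "pderiv (pderiv (hermite_poly N)) = smult ?c (smult (2 * real (Suc m)) (hermite_poly m))"
      and d1: "pderiv (hermite_poly N) = smult ?c (hermite_poly (Suc m))"
      using \<open>N = Suc n\<close> Suc by (simp_all only: pderiv_hermite pderiv_smult)
    have h: "hermite_poly N = [:0, 2:] * hermite_poly (Suc m) - smult (2 * real (Suc m)) (hermite_poly m)"
      using \<open>N = Suc n\<close> Suc by simp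
    have c: "2 * real N = ?c"
      using \<open>N = Suc n\<close> Suc by simp
    show ?thesis
      \<comment> \<open>\<open>d2\<close> is used before \<open>d1\<close>, which would also rewrite
        the inner derivative in the second derivative.\<close>
      unfolding hypergeometric_ode_def d2 unfolding d1 unfolding h c
      by (simp add: smult_diff_right)
  qed (auto simp: hypergeometric_ode_def Suc pderiv_pCons)
qed (simp add: hypergeometric_ode_def)

lemma degree_hermite: "degree (hermite_poly n) = n"
proof (induction n rule: hermite_poly.induct)
  case (3 n)
  hence "hermite_poly (Suc n) \<noteq> 0" by auto
  hence "degree ([:0, 2:] * hermite_poly (Suc n)) = Suc (Suc n)"
    using 3 by (subst degree_mult_eq) auto
  thus ?case
    using 3 by (simp only: hermite_poly.simps diff_conv_add_uminus) (subst degree_add_eq_left; simp)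
qed auto

section \<open>Laguerre polynomials\<close>

lemma coeff_laguerre:
  "coeff (laguerre_poly \<alpha> n) k =
     (if k \<le> n then (-1) ^ k * ((real n + \<alpha>) gchoose (n - k)) / fact k else 0)"
  by (auto simp: laguerre_poly_def coeff_sum coeff_monom if_distrib sum.delta cong: if_cong)

lemma degree_laguerre: "degree (laguerre_poly \<alpha> n) = n"
  by (rule antisym) (auto intro!: degree_le le_degree simp: coeff_laguerre)

text \<open>Here a0 = 0, so the recurrence has two terms and prescribes the ratio of consecutive
  coefficients, a ratio of neighbouring generalized binomial coefficients. From k = N on both terms
  vanish.\<close>

lemma hypergeometric_ode_laguerre:
  "hypergeometric_ode 0 1 0 (\<alpha> + 1) (-1) (real N) (laguerre_poly \<alpha> N)"
  unfolding hypergeometric_ode_iff_coeff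
proof
  fix k
  consider "k < N" | "k = N" | "k > N" by linarith
  hence "(\<alpha> + 1 + real k) * real (k + 1) * coeff (laguerre_poly \<alpha> N) (k + 1) +
    (real N - real k) * coeff (laguerre_poly \<alpha> N) k = 0"
  proof cases
    case 1
    define m where "m = N - Suc k"
    have N: "N = Suc (k + m)"
      using 1 by (simp add: m_def)
    have "real (Suc m) * ((real N + \<alpha>) gchoose Suc m) =
        (real N + \<alpha> - real m) * ((real N + \<alpha>) gchoose m)"
      using gbinomial_mult_1[of "real N + \<alpha>" m] by (simp add: algebra_simps)
    \<comment> \<open>Since N = k + m + 1, the factors are N + \<alpha> - m = \<alpha> + 1 + k and m
      + 1 = N - k.\<close>
    hence "(\<alpha> + 1 + real k) * ((real N + \<alpha>) gchoose m) =
        (real N - real k) * ((real N + \<alpha>) gchoose Suc m)"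
      by (simp add: N algebra_simps)
    hence "(-1) ^ k / fact k * ((\<alpha> + 1 + real k) * ((real N + \<alpha>) gchoose m)) =
      (-1) ^ k / fact k * ((real N - real k) * ((real N + \<alpha>) gchoose Suc m))"
      by simp
    moreover have "real (k + 1) * coeff (laguerre_poly \<alpha> N) (k + 1) =
        - ((-1) ^ k / fact k * ((real N + \<alpha>) gchoose m))"
      by (simp add: coeff_laguerre N del: of_nat_Suc)
    moreover have "coeff (laguerre_poly \<alpha> N) k = (-1) ^ k / fact k * ((real N + \<alpha>) gchoose Suc m)"
      by (simp add: coeff_laguerre N Suc_diff_le)
    ultimately show ?thesis
      by algebra
  qed (auto simp: coeff_laguerre)
  thus "0 * real (k + 1) * real (k + 2) * coeff (laguerre_poly \<alpha> N) (k + 2) +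
         (\<alpha> + 1 + 1 * real k) * real (k + 1) * coeff (laguerre_poly \<alpha> N) (k + 1) +
         (real N + - 1 * real k + 0 * real k * (real k - 1)) * coeff (laguerre_poly \<alpha> N) k = 0"
    by simp
qed

section \<open>Jacobi polynomials\<close>

text \<open>The terms of the hypergeometric series in t = (1 - x)/2, not the coefficients of the
  Jacobi polynomial in x.\<close>

definition jacobi_coeff :: "real \<Rightarrow> real \<Rightarrow> nat \<Rightarrow> nat \<Rightarrow> real" where
  "jacobi_coeff \<alpha> \<beta> n k = pochhammer (- real n) k * pochhammer (real n + \<alpha> + \<beta> + 1) k
                      / (pochhammer (\<alpha> + 1) k * fact k)"

lemma jacobi_coeff_Suc:
  assumes "\<alpha> > -1"
  shows   "(\<alpha> + 1 + real k) * real (k + 1) * jacobi_coeff \<alpha> \<beta> n (Suc k) =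
             (real k - real n) * (real n + \<alpha> + \<beta> + 1 + real k) * jacobi_coeff \<alpha> \<beta> n k"
proof -
  have "pochhammer (\<alpha> + 1) k > 0" "\<alpha> + 1 + real k > 0"
    using assms by (auto intro!: pochhammer_pos)
  thus ?thesis
    unfolding jacobi_coeff_def pochhammer_Suc fact_Suc
    by (simp add: divide_simps)
qed

text \<open>The hypergeometric polynomial in the variable \<open>t = (1 - x)/2\<close>, without the normalising factor.\<close>

definition jacobi_shifted :: "real \<Rightarrow> real \<Rightarrow> nat \<Rightarrow> real poly" where
  "jacobi_shifted \<alpha> \<beta> n = (\<Sum>k\<le>n. monom (jacobi_coeff \<alpha> \<beta> n k) k)"

text \<open>The series terminates by itself: the rising factorial of -n contains the factor 0 once k
  > n. Hence no case distinction on k remains.\<close>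

lemma coeff_jacobi_shifted: "coeff (jacobi_shifted \<alpha> \<beta> n) k = jacobi_coeff \<alpha> \<beta> n k"
proof -
  have "jacobi_coeff \<alpha> \<beta> n k = 0" if "k > n"
    using pochhammer_of_nat_eq_0_lemma[OF that, where 'a = real] by (simp add: jacobi_coeff_def)
  thus ?thesis
    by (auto simp: jacobi_shifted_def coeff_sum coeff_monom if_distrib sum.delta cong: if_cong)
qed

lemma jacobi_poly_eq:
  "jacobi_poly \<alpha> \<beta> n =
     smult (pochhammer (\<alpha> + 1) n / fact n) (pcompose (jacobi_shifted \<alpha> \<beta> n) [:1/2, -1/2:])"
proof -
  have "pcompose (monom c k) q = smult c (q ^ k)" for c :: real and k q
    by (induction k) (simp_all add: monom_0 monom_Suc pcompose_pCons)
  thus ?thesis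
    by (simp add: jacobi_poly_def jacobi_shifted_def jacobi_coeff_def pcompose_sum)
qed

lemma degree_jacobi:
  assumes "\<alpha> > -1" "\<beta> > -1"
  shows   "degree (jacobi_poly \<alpha> \<beta> n) = n"
proof -
  have pos: "pochhammer (\<alpha> + 1) k > 0" for k
    using assms by (intro pochhammer_pos) auto
  \<comment> \<open>For n >= 1 the base exceeds n - 1 >= 0. For n = 0 the base may be negative, but
    the product is empty.\<close>
  have "pochhammer (real n + \<alpha> + \<beta> + 1) n > 0" if "n > 0"
    using assms that by (intro pochhammer_pos) linarith
  hence "jacobi_coeff \<alpha> \<beta> n n \<noteq> 0"
    using pos[of n] by (cases "n = 0") (auto simp: jacobi_coeff_def pochhammer_of_nat_eq_0_iff)
  hence "degree (jacobi_shifted \<alpha> \<beta> n) = n"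
    by (intro antisym le_degree)
       (simp_all add: coeff_jacobi_shifted,
        auto simp: jacobi_shifted_def intro!: degree_sum_le order.trans[OF degree_monom_le])
  thus ?thesis
    using pos[of n] by (simp add: jacobi_poly_eq degree_pcompose)
qed

text \<open>This is the hypergeometric equation. The factor in front of the k-th coefficient splits
  as (n - k)(n + \<alpha> + \<beta> + 1 + k), which matches the ratio of consecutive terms.\<close>

lemma hypergeometric_ode_jacobi_shifted:
  assumes "\<alpha> > -1"
  shows   "hypergeometric_ode 0 1 (-1) (\<alpha> + 1) (- (\<alpha> + \<beta> + 2)) (real n * (real n + \<alpha> + \<beta> + 1))
             (jacobi_shifted \<alpha> \<beta> n)"
  unfolding hypergeometric_ode_iff_coeff coeff_jacobi_shifted
proof
  fix k
  show "0 * real (k + 1) * real (k + 2) * jacobi_coeff \<alpha> \<beta> n (k + 2) +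
         (\<alpha> + 1 + 1 * real k) * real (k + 1) * jacobi_coeff \<alpha> \<beta> n (k + 1) +
         (real n * (real n + \<alpha> + \<beta> + 1) + - (\<alpha> + \<beta> + 2) * real k + - 1 * real k * (real k - 1)) *
         jacobi_coeff \<alpha> \<beta> n k = 0"
    using jacobi_coeff_Suc[OF assms, of k \<beta> n] by (simp add: algebra_simps)
qed

text \<open>Substitution x = 1 - 2t in the hypergeometric equation: 1 - x^2 = 4 t (1 - t), and each
  derivative in x brings a factor -1/2. The identity is verified at every real point.\<close>

lemma hypergeometric_ode_jacobi:
  assumes "\<alpha> > -1"
  shows   "hypergeometric_ode 1 0 (-1) (\<beta> - \<alpha>) (- (\<alpha> + \<beta> + 2)) (real n * (real n + \<alpha> + \<beta> + 1))
             (jacobi_poly \<alpha> \<beta> n)"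
proof -
  define F where "F = jacobi_shifted \<alpha> \<beta> n"
  define c where "c = pochhammer (\<alpha> + 1) n / fact n"
  define P where "P = jacobi_poly \<alpha> \<beta> n"
  have P: "P = smult c (pcompose F [:1/2, -1/2:])"
    by (simp add: P_def jacobi_poly_eq c_def F_def)
  have P': "pderiv P = smult (- c / 2) (pcompose (pderiv F) [:1/2, -1/2:])"
    by (simp add: P pderiv_smult pderiv_pcompose pderiv_pCons)
  have P'': "pderiv (pderiv P) = smult (c / 4) (pcompose (pderiv (pderiv F)) [:1/2, -1/2:])"
    by (simp add: P' pderiv_minus pderiv_smult pderiv_pcompose pderiv_pCons)
  have "poly ([:1, 0, -1:] * pderiv (pderiv P) + [:\<beta> - \<alpha>, - (\<alpha> + \<beta> + 2):] * pderiv P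
          + smult (real n * (real n + \<alpha> + \<beta> + 1)) P) x = 0" for x
  proof -
    define t where "t = 1 / 2 - x / 2"
    have x: "x = 1 - 2 * t"
      by (simp add: t_def)
    have "poly ([:0, 1, -1:] * pderiv (pderiv F) + [:\<alpha> + 1, - (\<alpha> + \<beta> + 2):] * pderiv F
          + smult (real n * (real n + \<alpha> + \<beta> + 1)) F) t = 0"
      using hypergeometric_ode_jacobi_shifted[OF assms, of \<beta> n]
      by (simp add: hypergeometric_ode_def F_def)
    hence "c * ((t - t ^ 2) * poly (pderiv (pderiv F)) t + (\<alpha> + 1 - (\<alpha> + \<beta> + 2) * t) * poly (pderiv F) t
          + (real n * (real n + \<alpha> + \<beta> + 1)) * poly F t) = 0"
      by (simp add: algebra_simps power2_eq_square)
    \<comment> \<open>The factors 2 and 4 clear the denominators of the chain rule, so that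
      \<open>algebra\<close> works without division.\<close>
    moreover have "poly P x = c * poly F t" "2 * poly (pderiv P) x = - c * poly (pderiv F) t"
      "4 * poly (pderiv (pderiv P)) x = c * poly (pderiv (pderiv F)) t"
      unfolding P'' unfolding P' unfolding P poly_smult poly_pcompose by (simp_all add: t_def)
    ultimately have "4 * ((1 - x ^ 2) * poly (pderiv (pderiv P)) x
        + (\<beta> - \<alpha> - (\<alpha> + \<beta> + 2) * x) * poly (pderiv P) x
        + (real n * (real n + \<alpha> + \<beta> + 1)) * poly P x) = 0"
      using x by algebra
    thus ?thesis
      by (simp add: algebra_simps power2_eq_square)
  qed
  thus ?thesis
    unfolding hypergeometric_ode_def P_def poly_eq_poly_eq_iff[symmetric] by auto
qed

subsection \<open>The Riccati equations\<close>

lemma cpoly_pcompose_linear: "cpoly (pcompose p [:0, e:]) = pcompose (cpoly p) [:0, of_real e:]"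
  by (simp add: poly_eq_iff coeff_map_poly coeff_pcompose_linear)

lemmas fps_of_poly_simps = fps_of_poly_pCons fps_of_poly_0 fps_const_0_eq_0 fps_const_1_eq_1
  fps_of_nat fps_const_neg[symmetric] fps_const_mult[symmetric] numeral_fps_const[symmetric]

theorem mainTheorem4:
  fixes N :: nat
  assumes "N \<ge> 1"
  shows
    "(\<forall>P :: complex poly. degree P = N \<longrightarrow> moment_fun N P has_fps_expansion moment_fps N P)
   \<and> (\<forall>\<alpha> \<beta> :: real. \<alpha> > -1 \<and> \<beta> > -1 \<longrightarrow>
        (let P = cpoly (jacobi_poly \<alpha> \<beta> N); G = moment_fps N P; g = moment_fun N P in
           fps_const (1 / of_nat N) * ((1 - fps_X\<^sup>2) * fps_X) * fps_deriv G
             = (fps_X\<^sup>2 + fps_const (of_real (\<alpha> - \<beta>)) * fps_X + fps_const (of_real (\<alpha> + \<beta> + 1)))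
                 * fps_const (1 / of_nat N) * G
               + (1 - fps_X\<^sup>2) * G\<^sup>2 - fps_const (1 + of_real (1 + \<alpha> + \<beta>) / of_nat N)
         \<and> (\<forall>z\<in>regular_points P.
             (1 - z\<^sup>2) * z / of_nat N * deriv g z
               = (z\<^sup>2 + of_real (\<alpha> - \<beta>) * z + of_real (\<alpha> + \<beta> + 1)) * (1 / of_nat N) * g z
                 + (1 - z\<^sup>2) * (g z)\<^sup>2 - (1 + of_real (1 + \<alpha> + \<beta>) / of_nat N))))
   \<and> (let P = cpoly (chebyshev_T N); G = moment_fps N P; g = moment_fun N P in
           fps_const (1 / of_nat N) * ((1 - fps_X\<^sup>2) * fps_X) * fps_deriv G
             = fps_const (1 / of_nat N) * fps_X\<^sup>2 * G + (1 - fps_X\<^sup>2) * G\<^sup>2 - 1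
         \<and> (\<forall>z\<in>regular_points P.
             (1 - z\<^sup>2) * z / of_nat N * deriv g z
               = z\<^sup>2 / of_nat N * g z + (1 - z\<^sup>2) * (g z)\<^sup>2 - 1))
   \<and> (let P = cpoly (chebyshev_U N); G = moment_fps N P; g = moment_fun N P in
           fps_const (1 / of_nat N) * ((1 - fps_X\<^sup>2) * fps_X) * fps_deriv G
             = fps_const (1 / of_nat N) * (2 + fps_X\<^sup>2) * G + (1 - fps_X\<^sup>2) * G\<^sup>2
               - fps_const ((of_nat N + 2) / of_nat N)
         \<and> (\<forall>z\<in>regular_points P.
             (1 - z\<^sup>2) * z / of_nat N * deriv g z
               = (2 + z\<^sup>2) / of_nat N * g z + (1 - z\<^sup>2) * (g z)\<^sup>2
                 - (of_nat N + 2) / of_nat N))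
   \<and> (\<forall>\<alpha> :: real. \<alpha> > -1 \<longrightarrow>
        (let P = cpoly (laguerre_poly \<alpha> N); G = moment_fps N P; g = moment_fun N P in
           fps_X\<^sup>2 * fps_deriv G
             = of_nat N * fps_X * G\<^sup>2 + (fps_const (of_real \<alpha>) * fps_X - 1) * G + 1
         \<and> (\<forall>z\<in>regular_points P.
             z\<^sup>2 * deriv g z = of_nat N * z * (g z)\<^sup>2 + (of_real \<alpha> * z - 1) * g z + 1)))
   \<and> (\<forall>\<alpha> :: real. \<alpha> > -1 \<longrightarrow>
        (let P = cpoly (laguerre_poly \<alpha> N); S = cpoly (scaled_laguerre_poly \<alpha> N);
             Q = moment_fps N P oo (fps_const (1 / of_nat N) * fps_X);
             q = (\<lambda>z. moment_fun N P (z / of_nat N)) in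
           moment_fps N S = Q \<and> moment_fun N S = q
         \<and> fps_const (1 / of_nat N) * fps_X\<^sup>2 * fps_deriv Q
             = fps_X * Q\<^sup>2 + (fps_const (of_real \<alpha> / of_nat N) * fps_X - 1) * Q + 1
         \<and> (\<forall>z\<in>regular_points S.
             z\<^sup>2 / of_nat N * deriv q z
               = z * (q z)\<^sup>2 + (of_real \<alpha> * z / of_nat N - 1) * q z + 1)))
   \<and> (let P = cpoly (hermite_poly N); G = moment_fps N P; g = moment_fun N P in
           fps_const (1 / 2) * fps_X ^ 3 * fps_deriv G
             = fps_const (1 / 2) * fps_X\<^sup>2 * of_nat N * G\<^sup>2
               - (1 + fps_const (1 / 2) * fps_X\<^sup>2) * G + 1
         \<and> (\<forall>z\<in>regular_points P.
             z ^ 3 / 2 * deriv g z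
               = z\<^sup>2 / 2 * of_nat N * (g z)\<^sup>2 - (1 + z\<^sup>2 / 2) * g z + 1))
   \<and> (let P = cpoly (hermite_poly N); S = cpoly (scaled_hermite_poly N);
           Q = moment_fps N P oo (fps_const (1 / of_real (sqrt (real N))) * fps_X);
           q = (\<lambda>z. moment_fun N P (z / of_real (sqrt (real N)))) in
           moment_fps N S = Q \<and> moment_fun N S = q
         \<and> fps_const (1 / (2 * of_nat N)) * fps_X ^ 3 * fps_deriv Q
             = fps_const (1 / 2) * fps_X\<^sup>2 * Q\<^sup>2
               - (1 + fps_const (1 / (2 * of_nat N)) * fps_X\<^sup>2) * Q + 1
         \<and> (\<forall>z\<in>regular_points S.
             z ^ 3 / (2 * of_nat N) * deriv q z
               = z\<^sup>2 / 2 * (q z)\<^sup>2 - (1 + z\<^sup>2 / (2 * of_nat N)) * q z + 1))"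
proof -
  have N: "of_nat N \<noteq> (0 :: complex)"
    using assms by simp
  show ?thesis
  proof (intro conjI allI impI, goal_cases)
    case (1 P)
    show ?case
      by (rule moment_fun_has_fps_expansion)
  next
    case (2 \<alpha> \<beta>)
    hence ab: "\<alpha> > -1" "\<beta> > -1" by auto
    define P where "P = cpoly (jacobi_poly \<alpha> \<beta> N)"
    \<comment> \<open>The reversal of 1 - x^2 is z^2 - 1 and the general equation is in N G, so this
      factor makes the coefficient of G^2 equal to 1 - z^2. \<open>?A\<close> to \<open>?D\<close>
      are the coefficients of the desired equation in ascending powers of z.\<close>
    let ?s = "- 1 / of_nat N ^ 2 :: complex"
    let ?A = "[:0, 1 / of_nat N, 0, - (1 / of_nat N):] :: complex poly"
      and ?B = "[:of_real (\<alpha> + \<beta> + 1) * (1 / of_nat N), of_real (\<alpha> - \<beta>) * (1 / of_nat N), 1 / of_nat N:] :: complex poly"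
      and ?C = "[:1, 0, -1:] :: complex poly"
      and ?D = "[:- (1 + of_real (1 + \<alpha> + \<beta>) / of_nat N):] :: complex poly"
    have ode: "hypergeometric_ode 1 0 (-1)
        (of_real (\<beta> - \<alpha>)) (- of_real (\<alpha> + \<beta> + 2)) (of_nat N * (of_nat N + of_real (\<alpha> + \<beta> + 1))) P"
      using hypergeometric_ode_cpoly[OF hypergeometric_ode_jacobi[OF ab(1), of \<beta> N]]
      by (simp add: P_def add_ac)
    have deg: "degree P = N"
      by (simp add: P_def degree_map_poly degree_jacobi ab)
    have eqs: "?A = smult (?s * of_nat N) [:0, -1, 0, 1:]"
      "?B = smult (?s * of_nat N) [:- of_real (\<alpha> + \<beta> + 2) - (-1), of_real (\<beta> - \<alpha>) - 0, - 1:]"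
      "?C = smult (?s * of_nat N ^ 2) [:-1, 0, 1:]"
      "?D = [:?s * (of_nat N * (of_nat N + of_real (\<alpha> + \<beta> + 1))):]"
      using N by (simp_all add: field_simps power2_eq_square)
    note riccati = moment_riccati[OF ode deg assms eqs]
    show ?case
      unfolding Let_def P_def[symmetric]
    proof (intro conjI ballI, goal_cases)
      case 1
      show ?case
        using riccati(2)
        unfolding fps_of_poly_simps by algebra
    next
      case (2 z)
      show ?case
        using riccati(1)[rule_format, OF 2]
        unfolding poly_pCons poly_0 divide_inverse by algebra
    qed
  next
    case 3
    define P where "P = cpoly (chebyshev_T N)"
    let ?s = "- 1 / of_nat N ^ 2 :: complex"
    let ?A = "[:0, 1 / of_nat N, 0, - (1 / of_nat N):] :: complex poly"
      and ?B = "[:0, 0, 1 / of_nat N:] :: complex poly"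
      and ?C = "[:1, 0, -1:] :: complex poly"
      and ?D = "[:-1:] :: complex poly"
    have ode: "hypergeometric_ode 1 0 (-1)
        0 (- 1) (of_nat N ^ 2) P"
      using hypergeometric_ode_cpoly[OF hypergeometric_ode_chebyshev_T[of N]] by (simp add: P_def)
    have deg: "degree P = N"
      by (simp add: P_def degree_map_poly degree_chebyshev_T)
    have eqs: "?A = smult (?s * of_nat N) [:0, -1, 0, 1:]"
      "?B = smult (?s * of_nat N) [:- 1 - (-1), 0 - 0, - 1:]"
      "?C = smult (?s * of_nat N ^ 2) [:-1, 0, 1:]"
      "?D = [:?s * (of_nat N ^ 2):]"
      using N by (simp_all add: field_simps power2_eq_square)
    note riccati = moment_riccati[OF ode deg assms eqs]
    show ?case
      unfolding Let_def P_def[symmetric]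
    proof (intro conjI ballI, goal_cases)
      case 1
      show ?case
        using riccati(2)
        unfolding fps_of_poly_simps by algebra
    next
      case (2 z)
      show ?case
        using riccati(1)[rule_format, OF 2]
        unfolding poly_pCons poly_0 divide_inverse by algebra
    qed
  next
    case 4
    define P where "P = cpoly (chebyshev_U N)"
    let ?s = "- 1 / of_nat N ^ 2 :: complex"
    let ?A = "[:0, 1 / of_nat N, 0, - (1 / of_nat N):] :: complex poly"
      and ?B = "[:2 * (1 / of_nat N), 0, 1 / of_nat N:] :: complex poly"
      and ?C = "[:1, 0, -1:] :: complex poly"
      and ?D = "[:- ((of_nat N + 2) / of_nat N):] :: complex poly"
    have ode: "hypergeometric_ode 1 0 (-1)
        0 (- 3) (of_nat N * (of_nat N + 2)) P"
      using hypergeometric_ode_cpoly[OF hypergeometric_ode_chebyshev_U[of N]] by (simp add: P_def)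
    have deg: "degree P = N"
      by (simp add: P_def degree_map_poly degree_chebyshev_U)
    have eqs: "?A = smult (?s * of_nat N) [:0, -1, 0, 1:]"
      "?B = smult (?s * of_nat N) [:- 3 - (-1), 0 - 0, - 1:]"
      "?C = smult (?s * of_nat N ^ 2) [:-1, 0, 1:]"
      "?D = [:?s * (of_nat N * (of_nat N + 2)):]"
      using N by (simp_all add: field_simps power2_eq_square)
    note riccati = moment_riccati[OF ode deg assms eqs]
    show ?case
      unfolding Let_def P_def[symmetric]
    proof (intro conjI ballI, goal_cases)
      case 1
      show ?case
        using riccati(2)
        unfolding fps_of_poly_simps by algebra
    next
      case (2 z)
      show ?case
        using riccati(1)[rule_format, OF 2]
        unfolding poly_pCons poly_0 divide_inverse by algebra
    qed
  next
    case (5 \<alpha>)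
    define P where "P = cpoly (laguerre_poly \<alpha> N)"
    \<comment> \<open>The constant c is N here, and the equation is normalised to have constant term
      1.\<close>
    let ?s = "1 / of_nat N :: complex"
    let ?A = "[:0, 0, 1:] :: complex poly"
      and ?B = "[:-1, of_real \<alpha>:] :: complex poly"
      and ?C = "[:0, of_nat N:] :: complex poly"
      and ?D = "[:1:] :: complex poly"
    have ode: "hypergeometric_ode 0 1 0
        (of_real \<alpha> + 1) (- 1) (of_nat N) P"
      using hypergeometric_ode_cpoly[OF hypergeometric_ode_laguerre[of \<alpha> N]] by (simp add: P_def)
    have deg: "degree P = N"
      by (simp add: P_def degree_map_poly degree_laguerre)
    have eqs: "?A = smult (?s * of_nat N) [:0, 0, 1, 0:]"
      "?B = smult (?s * of_nat N) [:- 1 - 0, of_real \<alpha> + 1 - 1, - 0:]"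
      "?C = smult (?s * of_nat N ^ 2) [:0, 1, 0:]"
      "?D = [:?s * (of_nat N):]"
      using N by (simp_all add: field_simps power2_eq_square)
    note riccati = moment_riccati[OF ode deg assms eqs]
    show ?case
      unfolding Let_def P_def[symmetric]
    proof (intro conjI ballI, goal_cases)
      case 1
      show ?case
        using riccati(2)
        unfolding fps_of_poly_simps by algebra
    next
      case (2 z)
      show ?case
        using riccati(1)[rule_format, OF 2]
        unfolding poly_pCons poly_0 divide_inverse by algebra
    qed
  next
    case (6 \<alpha>)
    define P where "P = cpoly (laguerre_poly \<alpha> N)"
    define S where "S = cpoly (scaled_laguerre_poly \<alpha> N)"
    have S: "S = pcompose P [:0, of_nat N:]"
      by (simp add: S_def P_def scaled_laguerre_poly_def cpoly_pcompose_linear)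
    have "of_nat N \<noteq> (0 :: complex)"
      using N by simp
    note scale = moment_fun_scale[OF this, of N P, folded S]
    let ?s = "1 / of_nat N :: complex"
    let ?A = "[:0, 0, 1 / of_nat N:] :: complex poly"
      and ?B = "[:-1, of_real \<alpha> / of_nat N:] :: complex poly"
      and ?C = "[:0, 1:] :: complex poly"
      and ?D = "[:1:] :: complex poly"
    have ode: "hypergeometric_ode 0 (1 / of_nat N) 0
        ((of_real \<alpha> + 1) / of_nat N) (- 1) (of_nat N) S"
      using hypergeometric_ode_scale[OF hypergeometric_ode_cpoly[OF hypergeometric_ode_laguerre[of \<alpha> N]],
        of "of_nat N"] N by (simp add: S P_def)
    have deg: "degree S = N"
      by (simp add: S_def degree_map_poly scaled_laguerre_poly_def degree_laguerre degree_pcompose assms)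
    have eqs: "?A = smult (?s * of_nat N) [:0, 0, 1 / of_nat N, 0:]"
      "?B = smult (?s * of_nat N) [:- 1 - 0, (of_real \<alpha> + 1) / of_nat N - (1 / of_nat N), - 0:]"
      "?C = smult (?s * of_nat N ^ 2) [:0, 1 / of_nat N, 0:]"
      "?D = [:?s * (of_nat N):]"
      using N by (simp_all add: field_simps power2_eq_square)
    note riccati = moment_riccati[OF ode deg assms eqs]
    show ?case
      \<comment> \<open>Folding with \<open>scale\<close> turns Q and q into the moment series and
        function of \<open>S\<close>. The first two conjuncts become reflexive and the others are
        the general equation for \<open>S\<close>.\<close>
      unfolding Let_def P_def[symmetric] S_def[symmetric] scale[symmetric] fun_cong[OF scale(1), symmetric]
    proof (intro conjI ballI, goal_cases)
      case 3
      show ?case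
        using riccati(2)
        unfolding fps_of_poly_simps by algebra
    next
      case (4 z)
      show ?case
        using riccati(1)[rule_format, OF 4]
        unfolding poly_pCons poly_0 divide_inverse by algebra
    qed (rule refl)+
  next
    case 7
    define P where "P = cpoly (hermite_poly N)"
    \<comment> \<open>Again the constant term is normalised to 1, now with c = 2N.\<close>
    let ?s = "1 / (2 * of_nat N) :: complex"
    let ?A = "[:0, 0, 0, 1 / 2:] :: complex poly"
      and ?B = "[:-1, 0, - (1 / 2):] :: complex poly"
      and ?C = "[:0, 0, 1 / 2 * of_nat N:] :: complex poly"
      and ?D = "[:1:] :: complex poly"
    have ode: "hypergeometric_ode 1 0 0
        0 (- 2) (2 * of_nat N) P"
      using hypergeometric_ode_cpoly[OF hypergeometric_ode_hermite[of N]] by (simp add: P_def)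
    have deg: "degree P = N"
      by (simp add: P_def degree_map_poly degree_hermite)
    have eqs: "?A = smult (?s * of_nat N) [:0, 0, 0, 1:]"
      "?B = smult (?s * of_nat N) [:- 2 - 0, 0 - 0, - 1:]"
      "?C = smult (?s * of_nat N ^ 2) [:0, 0, 1:]"
      "?D = [:?s * (2 * of_nat N):]"
      using N by (simp_all add: field_simps power2_eq_square)
    note riccati = moment_riccati[OF ode deg assms eqs]
    show ?case
      unfolding Let_def P_def[symmetric]
    proof (intro conjI ballI, goal_cases)
      case 1
      show ?case
        using riccati(2)
        unfolding fps_of_poly_simps by algebra
    next
      case (2 z)
      show ?case
        using riccati(1)[rule_format, OF 2]
        unfolding poly_pCons poly_0 divide_inverse by algebra
    qed
  next
    case 8
    define P where "P = cpoly (hermite_poly N)"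
    define S where "S = cpoly (scaled_hermite_poly N)"
    have S: "S = pcompose P [:0, of_real (sqrt (real N)):]"
      by (simp add: S_def P_def scaled_hermite_poly_def cpoly_pcompose_linear)
    have "of_real (sqrt (real N)) \<noteq> (0 :: complex)"
      using N by simp
    note scale = moment_fun_scale[OF this, of N P, folded S]
    let ?s = "1 / (2 * of_nat N) :: complex"
    let ?A = "[:0, 0, 0, 1 / (2 * of_nat N):] :: complex poly"
      and ?B = "[:-1, 0, - (1 / (2 * of_nat N)):] :: complex poly"
      and ?C = "[:0, 0, 1 / 2:] :: complex poly"
      and ?D = "[:1:] :: complex poly"
    \<comment> \<open>Scaling by e = sqrt N divides a0 = 1 by e^2 = N, so no square root survives in
      the equation.\<close>
    have ode: "hypergeometric_ode (1 / of_nat N) 0 0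
        0 (- 2) (2 * of_nat N) S"
      using hypergeometric_ode_scale[OF hypergeometric_ode_cpoly[OF hypergeometric_ode_hermite[of N]],
        of "of_real (sqrt (real N))"] N by (simp add: S P_def flip: of_real_power)
    have deg: "degree S = N"
      by (simp add: S_def degree_map_poly scaled_hermite_poly_def degree_hermite degree_pcompose assms)
    have eqs: "?A = smult (?s * of_nat N) [:0, 0, 0, 1 / of_nat N:]"
      "?B = smult (?s * of_nat N) [:- 2 - 0, 0 - 0, - (1 / of_nat N):]"
      "?C = smult (?s * of_nat N ^ 2) [:0, 0, 1 / of_nat N:]"
      "?D = [:?s * (2 * of_nat N):]"
      using N by (simp_all add: field_simps power2_eq_square)
    note riccati = moment_riccati[OF ode deg assms eqs]
    show ?case
      unfolding Let_def P_def[symmetric] S_def[symmetric] scale[symmetric] fun_cong[OF scale(1), symmetric]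
    proof (intro conjI ballI, goal_cases)
      case 3
      show ?case
        using riccati(2)
        unfolding fps_of_poly_simps by algebra
    next
      case (4 z)
      show ?case
        using riccati(1)[rule_format, OF 4]
        unfolding poly_pCons poly_0 divide_inverse by algebra
    qed (rule refl)+
  qed
qed

end
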